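(* For any integer $n \geq 1$, $$\iota(n,K_3) = \iota(B_{n,K_3}, K_3) = \left\lfloor \frac{n}{4} \right\rfloor.$$
   Context: All graphs are finite and simple. For a graph $G$ and $v \in V(G)$, $N[v]$ is the set consisting of $v$ and its neighbours; for $D \subseteq V(G)$, $N[D] = \bigcup_{v \in D} N[v]$, and $G - N[D]$ is the subgraph of $G$ induced by $V(G) \setminus N[D]$. A set $D \subseteq V(G)$ is a $\{K_3\}$-isolating set of $G$ if $G - N[D]$ contains no triangle (no subgraph isomorphic to $K_3$). $\iota(G,K_3)$ denotes the size of a smallest $\{K_3\}$-isolating set of $G$. For an integer $n \geq 1$, $[n] = \{1,\dots,n\}$, and $\iota(n,K_3)$ denotes the maximum of $\iota(G,K_3)$ over all connected graphs $G$ with $V(G) = [n]$ and $G \not\simeq K_3$. $P_m$ denotes the path with vertex set $[m]$ and edges $\{i,i+1\}$, $1 \le i \le m-1$. The graph $B_{n,K_3}$ is defined as follows. If $n \leq 3$, then $B_{n,K_3} = P_n$. If $n \geq 4$, let $a = \lfloor n/4 \rfloor$ and $b = n - 3a$ (so $a \le b \le a+3$). Let $P^*$ be the graph with vertex set $[b]$ and edge set $E(P_a) \cup \{\{a,i\} \colon i \in [b] \setminus [a]\}$. Take copies $F_1, \dots, F_a$ of $K_3$ that are vertex-disjoint from each other and from $P^*$. Then $B_{n,K_3}$ is the connected $n$-vertex graph obtained from the union of $P^*, F_1, \dots, F_a$ by joining, for each $i \in [a]$, the vertex $i$ of $P^*$ to every vertex of $F_i$. *)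

theory Defs
  imports "Graph_Theory.Graph_Theory"
begin

text \<open>
  A finite simple graph is a \<^locale>\<open>pair_graph\<close>: a finite, loop-free, symmetric digraph whose
  arcs are pairs of vertices, the edge \<open>{u, v}\<close> being represented by the two arcs
  \<open>(u, v)\<close> and \<open>(v, u)\<close>. The coercion \<^const>\<open>with_proj\<close> is written out where a general
  \<^typ>\<open>('a, 'b) pre_digraph\<close> is expected.
\<close>

definition complete_on :: "'a set \<Rightarrow> 'a pair_pre_digraph" where
  "complete_on S = \<lparr> pverts = S, parcs = {(u, v). u \<in> S \<and> v \<in> S \<and> u \<noteq> v} \<rparr>"

definition K3 :: "nat pair_pre_digraph" where
  "K3 = complete_on {1..3}"

definition closed_nbhd :: "'a pair_pre_digraph \<Rightarrow> 'a \<Rightarrow> 'a set" where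
  "closed_nbhd G v = insert v {u \<in> pverts G. (v, u) \<in> parcs G}"

definition closed_nbhd_set :: "'a pair_pre_digraph \<Rightarrow> 'a set \<Rightarrow> 'a set" where
  "closed_nbhd_set G D = (\<Union>v\<in>D. closed_nbhd G v)"

definition contains_K3 :: "('a, 'b) pre_digraph \<Rightarrow> bool" where
  "contains_K3 G \<longleftrightarrow> (\<exists>H. subgraph H G \<and> digraph_iso H (with_proj K3))"

definition K3_isolating :: "'a pair_pre_digraph \<Rightarrow> 'a set \<Rightarrow> bool" where
  "K3_isolating G D \<longleftrightarrow>
     D \<subseteq> pverts G \<and> \<not> contains_K3 (with_proj G \<restriction> (pverts G - closed_nbhd_set G D))"

definition iota_K3 :: "'a pair_pre_digraph \<Rightarrow> nat" where
  "iota_K3 G = Min {card D | D. K3_isolating G D}"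

definition admissible_graphs :: "nat \<Rightarrow> nat pair_pre_digraph set" where
  "admissible_graphs n = {G. pair_graph G \<and> pverts G = {1..n} \<and>
     Digraph_Component.connected (with_proj G) \<and> \<not> digraph_iso (with_proj G) (with_proj K3)}"

definition iota_max_K3 :: "nat \<Rightarrow> nat" where
  "iota_max_K3 n = Max {iota_K3 G | G. G \<in> admissible_graphs n}"

definition path_graph :: "nat \<Rightarrow> nat pair_pre_digraph" where
  "path_graph m = \<lparr> pverts = {1..m}, parcs = symcl {(i, i + 1) | i. 1 \<le> i \<and> i < m} \<rparr>"

definition P_star :: "nat \<Rightarrow> nat \<Rightarrow> nat pair_pre_digraph" where
  "P_star a b = \<lparr> pverts = {1..b},
     parcs = parcs (path_graph a) \<union> symcl {(a, i) | i. i \<in> {1..b} - {1..a}} \<rparr>"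

text \<open>
  For \<open>n \<ge> 4\<close> the pairwise disjoint copies of \<open>K3\<close> are placed on the consecutive blocks
  \<open>{b + 1, b + 2, b + 3}\<close>, \<open>{b + 4, b + 5, b + 6}\<close>, and so on, following the vertices \<open>{1..b}\<close> of \<^const>\<open>P_star\<close>, so that
  \<open>B_graph n\<close> below has vertex set \<open>{1..n}\<close>.
\<close>

definition F_copy :: "nat \<Rightarrow> nat \<Rightarrow> nat pair_pre_digraph" where
  "F_copy b i = complete_on {b + 3 * i - 2 .. b + 3 * i}"

definition B_graph :: "nat \<Rightarrow> nat pair_pre_digraph" where
  "B_graph n = (if n \<le> 3 then path_graph n else
     (let a = n div 4; b = n - 3 * a in
       \<lparr> pverts = pverts (P_star a b) \<union> (\<Union>i\<in>{1..a}. pverts (F_copy b i)),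
         parcs = parcs (P_star a b) \<union> (\<Union>i\<in>{1..a}. parcs (F_copy b i)) \<union>
           symcl {(i, x) | i x. i \<in> {1..a} \<and> x \<in> pverts (F_copy b i)} \<rparr>))"

lemma digraph_iso_K3_complete_on:
  assumes "card S = 3"
  shows "digraph_iso (with_proj (complete_on S)) (with_proj K3)"
proof -
  have "finite S" using assms by (metis card.infinite zero_neq_numeral)
  then obtain f where f: "bij_betw f S {1..3::nat}"
    using assms by (metis card_atLeastAtMost diff_Suc_1 finite_atLeastAtMost finite_same_card_bij)
  let ?h = "\<lparr> iso_verts = f, iso_arcs = map_prod f f, iso_head = snd, iso_tail = fst \<rparr>"
  have inj: "inj_on f S" and im: "f ` S = {1..3}" using f by (auto simp: bij_betw_def)
  have "pre_digraph.digraph_isomorphism (with_proj (complete_on S)) ?h"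
    unfolding pre_digraph.digraph_isomorphism_def
    using inj by (auto simp: complete_on_def wf_digraph_def inj_on_def)
  moreover have "with_proj K3 = app_iso ?h (with_proj (complete_on S))"
  proof -
    have "parcs K3 = map_prod f f ` parcs (complete_on S)"
    proof (rule set_eqI, clarify)
      fix x y
      show "(x, y) \<in> parcs K3 \<longleftrightarrow> (x, y) \<in> map_prod f f ` parcs (complete_on S)"
        unfolding K3_def complete_on_def im[symmetric]
        using inj by (auto simp: inj_on_def image_iff map_prod_def split: prod.splits)
    qed
    then show ?thesis using im
      by (simp add: with_proj_def app_iso_def complete_on_def K3_def)
  qed
  ultimately show ?thesis unfolding digraph_iso_def by blast
qed

lemma F_copy_iso_K3:
  assumes "i \<ge> 1"
  shows "digraph_iso (with_proj (F_copy b i)) (with_proj K3)"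
  unfolding F_copy_def by (rule digraph_iso_K3_complete_on) (use assms in simp)

lemma not_contains_K3_empty:
  assumes "verts G = {}"
  shows "\<not> contains_K3 G"
  using assms
  by (auto simp: contains_K3_def subgraph_def digraph_iso_def app_iso_def with_proj_def K3_def complete_on_def)

lemma K3_isolating_verts: "K3_isolating G (pverts G)"
  by (auto simp: K3_isolating_def closed_nbhd_set_def closed_nbhd_def intro!: not_contains_K3_empty)

lemma iota_K3_sizes:
  assumes "finite (pverts G)"
  shows "finite {card D | D. K3_isolating G D}" and "{card D | D. K3_isolating G D} \<noteq> {}"
proof -
  have "{card D | D. K3_isolating G D} \<subseteq> card ` Pow (pverts G)"
    by (auto simp: K3_isolating_def)
  then show "finite {card D | D. K3_isolating G D}"
    by (rule finite_subset) (use assms in simp)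
  show "{card D | D. K3_isolating G D} \<noteq> {}"
    using K3_isolating_verts[of G] by blast
qed

lemma finite_admissible_graphs: "finite (admissible_graphs n)"
proof -
  have "admissible_graphs n \<subseteq>
      (\<lambda>A. \<lparr> pverts = {1..n}, parcs = A \<rparr>) ` Pow ({1..n} \<times> {1..n})"
  proof
    fix G assume G: "G \<in> admissible_graphs n"
    then interpret pair_graph G by (simp add: admissible_graphs_def)
    have "parcs G \<subseteq> {1..n} \<times> {1..n}"
      using G in_arcsD1 in_arcsD2 by (auto simp: admissible_graphs_def)
    moreover have "G = \<lparr> pverts = {1..n}, parcs = parcs G \<rparr>"
      using G by (simp add: admissible_graphs_def)
    ultimately show "G \<in> (\<lambda>A. \<lparr> pverts = {1..n}, parcs = A \<rparr>) ` Pow ({1..n} \<times> {1..n})"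
      by blast
  qed
  then show ?thesis by (rule finite_subset) simp
qed

lemma pverts_B_graph: "pverts (B_graph n) = {1..n}"
proof (cases "n \<le> 3")
  case True
  then show ?thesis by (simp add: B_graph_def path_graph_def)
next
  case False
  define a b where "a = n div 4" and "b = n - 3 * a"
  have n: "n = b + 3 * a" by (auto simp: a_def b_def)
  have "x \<in> (\<Union>i\<in>{1..a}. {b + 3 * i - 2 .. b + 3 * i})" if "b < x" "x \<le> b + 3 * a" for x
  proof
    let ?i = "(x - b + 2) div 3"
    show "?i \<in> {1..a}" using that by auto
    show "x \<in> {b + 3 * ?i - 2 .. b + 3 * ?i}" using that by auto
  qed
  then have "{b<..b + 3 * a} \<subseteq> (\<Union>i\<in>{1..a}. {b + 3 * i - 2 .. b + 3 * i})"
    by (meson greaterThanAtMost_iff subsetI)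
  moreover have "(\<Union>i\<in>{1..a}. {b + 3 * i - 2 .. b + 3 * i}) \<subseteq> {1..b + 3 * a}"
    by auto
  moreover have "{1..b + 3 * a} = {1..b} \<union> {b<..b + 3 * a}" by auto
  ultimately have "{1..b} \<union> (\<Union>i\<in>{1..a}. {b + 3 * i - 2 .. b + 3 * i}) = {1..b + 3 * a}"
    by blast
  moreover have "pverts (B_graph n) = {1..b} \<union> (\<Union>i\<in>{1..a}. {b + 3 * i - 2 .. b + 3 * i})"
    using False
    by (simp add: B_graph_def P_star_def F_copy_def complete_on_def Let_def flip: a_def b_def)
  ultimately show ?thesis using n by simp
qed

lemma pair_graph_B_graph: "pair_graph (B_graph n)"
proof -
  have sub: "parcs (B_graph n) \<subseteq> {1..n} \<times> {1..n}"
  proof (cases "n \<le> 3")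
    case True
    then show ?thesis by (auto simp: B_graph_def path_graph_def symcl_def)
  next
    case False
    define a b where "a = n div 4" and "b = n - 3 * a"
    have ab: "a \<le> b" "1 \<le> a" "n = b + 3 * a" using False by (auto simp: a_def b_def)
    have "parcs (B_graph n) \<subseteq> {1..b + 3 * a} \<times> {1..b + 3 * a}"
      using False ab(1,2)
      by (auto simp: B_graph_def P_star_def path_graph_def F_copy_def complete_on_def Let_def symcl_def
          simp flip: a_def b_def)
    then show ?thesis using ab(3) by simp
  qed
  have "sym (parcs (B_graph n))"
  proof -
    have symcl: "sym (symcl R)" for R :: "nat rel" by (auto simp: symcl_def sym_def)
    have "sym (parcs (path_graph m))" for m by (simp add: path_graph_def symcl)
    moreover from this have "sym (parcs (P_star a b))" for a b
      by (simp add: P_star_def symcl sym_Un)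
    moreover have "sym (parcs (F_copy b i))" for b i
      by (auto simp: F_copy_def complete_on_def sym_def)
    ultimately show ?thesis
      by (auto simp: B_graph_def Let_def symcl intro!: sym_Un sym_UNION)
  qed
  moreover have "u \<noteq> v" if "(u, v) \<in> parcs (B_graph n)" for u v
  proof (cases "n \<le> 3")
    case True
    then show ?thesis using that by (auto simp: B_graph_def path_graph_def symcl_def)
  next
    case False
    define a b where "a = n div 4" and "b = n - 3 * a"
    have ab: "a \<le> b" "1 \<le> a" "n = b + 3 * a" using False by (auto simp: a_def b_def)
    show ?thesis
      using False ab(1,2) that
      by (auto simp: B_graph_def P_star_def path_graph_def F_copy_def complete_on_def Let_def symcl_def
          simp flip: a_def b_def)
  qed
  moreover have "finite (parcs (B_graph n))" using sub by (rule finite_subset) simp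
  ultimately show ?thesis
    using sub by unfold_locales (auto simp: pverts_B_graph symmetric_def)
qed

lemma connected_B_graph:
  assumes "n \<ge> 1"
  shows "Digraph_Component.connected (with_proj (B_graph n))"
proof -
  interpret pair_graph "B_graph n" by (rule pair_graph_B_graph)
  have path: "1 \<rightarrow>\<^sup>*\<^bsub>B_graph n\<^esub> i"
    if "\<And>i. 1 \<le> i \<Longrightarrow> i < m \<Longrightarrow> (i, i + 1) \<in> parcs (B_graph n)" "1 \<le> i" "i \<le> m" for i m
    using that(2,3)
  proof (induction i rule: nat_induct_at_least)
    case base
    then show ?case using assms by (simp add: pverts_B_graph reachable_refl)
  next
    case (Suc i)
    then show ?case using that(1)[of i] by (auto intro: reachable_adj_trans)
  qed
  have reach: "1 \<rightarrow>\<^sup>*\<^bsub>B_graph n\<^esub> v" if v: "v \<in> pverts (B_graph n)" for v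
  proof (cases "n \<le> 3")
    case True
    then show ?thesis using v
      by (intro path[of n]) (auto simp: pverts_B_graph, auto simp: B_graph_def path_graph_def symcl_def)
  next
    case False
    define a b where "a = n div 4" and "b = n - 3 * a"
    have ab: "a \<le> b" "1 \<le> a" using False by (auto simp: a_def b_def)
    have B: "B_graph n =
       \<lparr> pverts = pverts (P_star a b) \<union> (\<Union>i\<in>{1..a}. pverts (F_copy b i)),
         parcs = parcs (P_star a b) \<union> (\<Union>i\<in>{1..a}. parcs (F_copy b i)) \<union>
           symcl {(i, x) | i x. i \<in> {1..a} \<and> x \<in> pverts (F_copy b i)} \<rparr>"
      using False by (simp add: B_graph_def Let_def flip: a_def b_def)
    have spine: "1 \<rightarrow>\<^sup>*\<^bsub>B_graph n\<^esub> i" if "1 \<le> i" "i \<le> a" for i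
      using that by (intro path[of a]) (auto simp: B P_star_def path_graph_def symcl_def)
    from v consider "1 \<le> v \<and> v \<le> a" | "a < v \<and> v \<le> b"
      | i where "i \<in> {1..a}" "v \<in> pverts (F_copy b i)"
      by (fastforce simp: B P_star_def)
    then show ?thesis
    proof cases
      case 1
      then show ?thesis using spine by simp
    next
      case 2
      then have "(a, v) \<in> parcs (B_graph n)" by (auto simp: B P_star_def symcl_def)
      then show ?thesis using spine[of a] ab by (auto intro: reachable_adj_trans)
    next
      case (3 i)
      then have "(i, v) \<in> parcs (B_graph n)" by (auto simp: B symcl_def)
      then show ?thesis using spine[of i] 3 by (auto intro: reachable_adj_trans)
    qed
  qed
  have "strongly_connected (with_proj (B_graph n))"
  proof (rule strongly_connectedI)
    show "verts (with_proj (B_graph n)) \<noteq> {}" using assms by (simp add: pverts_B_graph)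
    fix u v assume "u \<in> verts (with_proj (B_graph n))" "v \<in> verts (with_proj (B_graph n))"
    then show "u \<rightarrow>\<^sup>*\<^bsub>B_graph n\<^esub> v"
      using reach symmetric_reachable[OF pair_sym_arcs] by (auto intro: reachable_trans)
  qed
  moreover have "mk_symmetric (with_proj (B_graph n)) = B_graph n"
  proof -
    have "(\<Union>e\<in>parcs (B_graph n). {(fst e, snd e), (snd e, fst e)}) = parcs (B_graph n)"
      using pair_sym_arcs by (auto simp: symmetric_def sym_def)
    then show ?thesis by (simp add: mk_symmetric_def)
  qed
  ultimately show ?thesis by (simp add: connected_def)
qed

lemma B_graph_admissible:
  assumes "n \<ge> 1"
  shows "B_graph n \<in> admissible_graphs n"
proof -
  have "\<not> digraph_iso (with_proj (B_graph n)) (with_proj K3)"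
  proof
    assume "digraph_iso (with_proj (B_graph n)) (with_proj K3)"
    then obtain h where h: "pre_digraph.digraph_isomorphism (with_proj (B_graph n)) h"
      and K: "with_proj K3 = app_iso h (with_proj (B_graph n))"
      unfolding digraph_iso_def by blast
    have "pverts K3 = iso_verts h ` pverts (B_graph n)"
      using arg_cong[OF K, of verts] by simp
    moreover have "inj_on (iso_verts h) (pverts (B_graph n))"
      using h by (simp add: pre_digraph.digraph_isomorphism_def)
    ultimately have "card (pverts K3) = n" by (simp add: card_image pverts_B_graph)
    then have n: "n = 3" by (simp add: K3_def complete_on_def)
    have "parcs K3 = iso_arcs h ` parcs (B_graph n)"
      using arg_cong[OF K, of arcs] by simp
    moreover have "inj_on (iso_arcs h) (parcs (B_graph n))"
      using h by (simp add: pre_digraph.digraph_isomorphism_def)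
    ultimately have "card (parcs K3) = card (parcs (B_graph n))" by (simp add: card_image)
    moreover have "parcs K3 = {(1,2),(1,3),(2,1),(2,3),(3,1),(3,2)}"
      by (auto simp: K3_def complete_on_def)
    moreover have "parcs (B_graph n) = {(1,2),(2,3),(2,1),(3,2)}"
      by (auto simp: n B_graph_def path_graph_def symcl_def)
    ultimately show False by simp
  qed
  then show ?thesis
    using assms by (simp add: admissible_graphs_def pair_graph_B_graph pverts_B_graph connected_B_graph)
qed

end

theory Submission
  imports Defs
begin

text \<open>
  Connectedness is weakened to "no component is a triangle", so that the upper bound goes by
  induction over vertex sets \<open>S\<close> of a fixed graph and vertex sets can be deleted freely. Take \<open>v\<close> of
  maximal degree; it is at least 3 unless \<open>S\<close> has no triangle. If \<open>S - N[v]\<close> has no triangle component,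
  use \<open>v\<close> and delete the at least 4 vertices of \<open>N[v]\<close>. If some triangle component of \<open>S - N[v]\<close> is
  linked to a single \<open>x \<in> N(v)\<close>, use \<open>x\<close> and delete \<open>X\<close>, consisting of \<open>x\<close> and all such components.
  Otherwise let \<open>T\<close> be a triangle component linked to \<open>x \<in> N(v)\<close>, at \<open>y \<in> T\<close>; use \<open>y\<close> and delete
  \<open>X = {x} \<union> T\<close>, which lies in \<open>N[y]\<close>. The only possible triangle component of \<open>S - X\<close> is the one at
  \<open>v\<close>; if it is there, use \<open>x\<close> in both cases and delete this component as well. In the last case \<open>v\<close>
  has degree 3, and the maximality of that degree excludes triangles between the two deleted ones.

  For the lower bound, an isolating set of \<open>B\<^sub>n\<close> meets the disjoint closed neighbourhoods of the
  \<open>F\<^sub>i\<close>.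
\<close>

section \<open>Triangles and isolating sets within a vertex set\<close>

definition triangle :: "'a rel \<Rightarrow> 'a set \<Rightarrow> bool" where
  "triangle E T \<longleftrightarrow> card T = 3 \<and> (\<forall>u\<in>T. \<forall>w\<in>T. u \<noteq> w \<longrightarrow> (u, w) \<in> E)"

definition triangle_component :: "'a rel \<Rightarrow> 'a set \<Rightarrow> 'a set \<Rightarrow> bool" where
  "triangle_component E S T \<longleftrightarrow> T \<subseteq> S \<and> triangle E T \<and> E `` T \<inter> S \<subseteq> T"

text \<open>The relation \<open>E\<close> is not restricted to \<open>S\<close>: neighbours of
  \<open>D\<close> outside \<open>S\<close> simply drop out in the difference.\<close>

definition triangle_isolating :: "'a rel \<Rightarrow> 'a set \<Rightarrow> 'a set \<Rightarrow> bool" where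
  "triangle_isolating E S D \<longleftrightarrow> D \<subseteq> S \<and> (\<nexists>T. T \<subseteq> S - (D \<union> E `` D) \<and> triangle E T)"

lemma triangle_finite: "triangle E T \<Longrightarrow> finite T"
  by (metis card.infinite triangle_def zero_neq_numeral)

lemma triangle_subset_eq: "triangle E R \<Longrightarrow> triangle E T \<Longrightarrow> R \<subseteq> T \<Longrightarrow> R = T"
  by (metis card_subset_eq triangle_def triangle_finite)

lemma triangleE:
  assumes "triangle E T" and "v \<in> T"
  obtains a b where "T = {v, a, b}" "a \<noteq> b" "a \<noteq> v" "b \<noteq> v"
proof -
  have "card (T - {v}) = 2" using assms by (simp add: triangle_def)
  then obtain a b where "T - {v} = {a, b}" "a \<noteq> b" by (auto simp: card_2_iff)
  then show thesis using that[of a b] assms(2) by blast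
qed

text \<open>A triangle of \<open>S\<close> avoiding the closed neighbourhood of \<open>x\<close>
  misses \<open>Y\<close> by \<open>Ytri\<close>, so \<open>D\<close> deals with it inside
  \<open>S - Y\<close>; the at least 4 vertices of \<open>Y\<close> pay for \<open>x\<close>. This
  form allows a \<open>Y\<close> that is not contained in that neighbourhood.\<close>

lemma triangle_isolating_insert:
  assumes D: "triangle_isolating E (S - Y) D" and x: "x \<in> S" and Y: "finite S" "Y \<subseteq> S"
    and "4 \<le> card Y" and "4 * card D \<le> card (S - Y)"
    and Ytri: "\<And>T. \<lbrakk>T \<subseteq> S; triangle E T; x \<notin> T; (E `` {x}) \<inter> T = {}\<rbrakk> \<Longrightarrow> T \<inter> Y = {}"
  shows "\<exists>D. triangle_isolating E S D \<and> 4 * card D \<le> card S"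
proof (intro exI conjI)
  have "\<not> triangle E T" if "T \<subseteq> S - (insert x D \<union> E `` insert x D)" for T
  proof
    assume T: "triangle E T"
    have "T \<inter> Y = {}" using that by (intro Ytri T) auto
    then have "T \<subseteq> (S - Y) - (D \<union> E `` D)" using that by blast
    then show False using D T by (auto simp: triangle_isolating_def)
  qed
  then show "triangle_isolating E S (insert x D)"
    using D x by (auto simp: triangle_isolating_def)
  have "card (S - Y) = card S - card Y" "card Y \<le> card S"
    using Y by (auto simp: card_Diff_subset finite_subset card_mono)
  moreover have "card (insert x D) \<le> Suc (card D)"
    by (simp add: card_insert_le_m1 card_insert_if)
  ultimately show "4 * card (insert x D) \<le> card S" using assms by linarith
qed

section \<open>The upper bound for vertex sets without triangle components\<close>

lemma triangle_isolation_bound: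
  assumes E: "sym E" "irrefl E" and "finite S"
    and "\<nexists>T. triangle_component E S T"
  shows "\<exists>D. triangle_isolating E S D \<and> 4 * card D \<le> card S"
  using assms(3,4)
proof (induction "card S" arbitrary: S rule: less_induct)
  case less
  note fin = \<open>finite S\<close>
  note noS = \<open>\<nexists>T. triangle_component E S T\<close>
  have symD: "(b, a) \<in> E" if "(a, b) \<in> E" for a b using that E(1) by (auto dest: symD)
  have irr: "(a, a) \<notin> E" for a using E(2) by (auto simp: irrefl_def)
  \<comment> \<open>One round of the induction: each case below only supplies the deleted set
    \<open>Y\<close> and the chosen vertex \<open>x\<close>.\<close>
  have IH: "\<exists>D. triangle_isolating E S D \<and> 4 * card D \<le> card S"
    if Y: "Y \<subseteq> S" "4 \<le> card Y" and no: "\<nexists>T. triangle_component E (S - Y) T" and x: "x \<in> S"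
      and Ytri: "\<And>T. \<lbrakk>T \<subseteq> S; triangle E T; x \<notin> T; (E `` {x}) \<inter> T = {}\<rbrakk> \<Longrightarrow> T \<inter> Y = {}" for Y x
  proof -
    have "Y \<noteq> {}" using Y by auto
    then have "card (S - Y) < card S" using Y fin by (intro psubset_card_mono) auto
    then obtain D where "triangle_isolating E (S - Y) D" "4 * card D \<le> card (S - Y)"
      using less.hyps[of "S - Y"] fin no by blast
    then show ?thesis using triangle_isolating_insert[of E S Y D x] Y x fin Ytri by blast
  qed
  show ?case
  proof (cases "\<exists>T\<subseteq>S. triangle E T")
    case False
    then show ?thesis by (intro exI[of _ "{}"]) (auto simp: triangle_isolating_def)
  next
    case True
    then obtain T0 where T0: "T0 \<subseteq> S" "triangle E T0" by blast
    define nb where "nb v = E `` {v} \<inter> S" for v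
    have finnb: "finite (nb v)" for v using fin by (simp add: nb_def)
    \<comment> \<open>\<open>T0\<close> is not a component, so one of its vertices has a neighbour
      outside \<open>T0\<close> besides its two inside.\<close>
    have "\<exists>v\<in>S. 3 \<le> card (nb v)"
    proof -
      obtain u w where uw: "u \<in> T0" "w \<in> S - T0" "(u, w) \<in> E"
        using noS T0 unfolding triangle_component_def by blast
      obtain a b where ab: "T0 = {u, a, b}" "a \<noteq> b" "a \<noteq> u" "b \<noteq> u" using triangleE T0(2) uw(1) .
      have "{a, b, w} \<subseteq> nb u" using T0 uw ab by (auto simp: nb_def triangle_def)
      then have "card {a, b, w} \<le> card (nb u)" using finnb by (rule card_mono[rotated])
      moreover have "card {a, b, w} = 3" using ab uw by auto
      ultimately show ?thesis using uw T0 by auto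
    qed
    moreover obtain v where v: "v \<in> S" "\<And>u. u \<in> S \<Longrightarrow> card (nb u) \<le> card (nb v)"
    proof -
      have "S \<noteq> {}" using calculation by blast
      then have "Max ((\<lambda>u. card (nb u)) ` S) \<in> (\<lambda>u. card (nb u)) ` S" using fin by simp
      then obtain v where "v \<in> S" "card (nb v) = Max ((\<lambda>u. card (nb u)) ` S)" by auto
      then show thesis using that fin by (metis Max_ge finite_imageI imageI)
    qed
    ultimately have deg: "3 \<le> card (nb v)" by (meson le_trans)
    define S' where "S' = S - insert v (nb v)"
    have vnb: "v \<notin> nb v" using irr by (simp add: nb_def)
    show ?thesis
    proof (cases "\<exists>T. triangle_component E S' T")
      case False
      show ?thesis
      proof (rule IH[of "insert v (nb v)" v])
        show "4 \<le> card (insert v (nb v))" using deg vnb finnb by simp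
      qed (use v False in \<open>auto simp: nb_def S'_def\<close>)
    next
      case True
      define links where "links T = {x \<in> nb v. E `` {x} \<inter> T \<noteq> {}}" for T
      \<comment> \<open>\<open>v\<close> itself has no neighbour in \<open>T\<close>, so without
        links \<open>T\<close> would be a triangle component of \<open>S\<close>.\<close>
      have links_ne: "links T \<noteq> {}" if T: "triangle_component E S' T" for T
      proof
        assume "links T = {}"
        moreover have "v \<notin> E `` T" using T symD by (auto simp: triangle_component_def S'_def nb_def)
        ultimately have "triangle_component E S T"
          using T symD by (fastforce simp: triangle_component_def S'_def links_def nb_def)
        then show False using noS by blast
      qed
      have nbT: "w \<in> T \<or> w \<in> links T"
        if "triangle_component E S' T" "u \<in> T" "(u, w) \<in> E" "w \<in> S" for T u w
        using that symD by (fastforce simp: triangle_component_def S'_def nb_def links_def)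
      \<comment> \<open>If \<open>T'\<close> met the neighbours of \<open>v\<close>, it would
        contain \<open>v\<close>, which survives in \<open>S - X\<close>. An edge from
        \<open>T'\<close> to the rest of \<open>S'\<close> would have to end in \<open>X\<close>,
        where only \<open>x\<close> may have edges leaving \<open>X\<close> into \<open>S'\<close>,
        and \<open>x\<close> is not in \<open>S'\<close>.\<close>
      have comp': "triangle_component E S' T' \<and> links T' \<subseteq> {x}"
        if T': "triangle_component E (S - X) T'" "v \<notin> T'" and X: "x \<in> X" "v \<notin> X" "X \<inter> nb v = {x}"
          "\<And>u w. u \<in> X \<Longrightarrow> u \<noteq> x \<Longrightarrow> (u, w) \<in> E \<Longrightarrow> w \<in> S' \<Longrightarrow> w \<in> X" for T' x X
      proof -
        have "T' \<inter> nb v = {}"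
          using T' X v(1) symD by (fastforce simp: triangle_component_def nb_def)
        then have "T' \<subseteq> S'" using T' by (auto simp: triangle_component_def S'_def)
        moreover have "E `` T' \<inter> S' \<subseteq> T'"
        proof
          fix w assume w: "w \<in> E `` T' \<inter> S'"
          then obtain u where u: "u \<in> T'" "(u, w) \<in> E" by blast
          have "w \<notin> X"
          proof
            assume "w \<in> X"
            moreover have "w \<noteq> x" using w X by (auto simp: S'_def)
            ultimately have "u \<in> X" using X(4)[of w u] symD u \<open>T' \<subseteq> S'\<close> by blast
            then show False using T' u by (auto simp: triangle_component_def)
          qed
          then show "w \<in> T'" using w T' u by (auto simp: triangle_component_def S'_def)
        qed
        moreover have "links T' \<subseteq> {x}"
        proof
          fix w assume "w \<in> links T'"
          then obtain t where t: "w \<in> nb v" "t \<in> T'" "(w, t) \<in> E" by (auto simp: links_def)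
          show "w \<in> {x}"
          proof (rule ccontr)
            assume "w \<notin> {x}"
            then have "w \<in> S - X" using t X by (auto simp: nb_def)
            then have "w \<in> T'"
              using t(2) symD[OF t(3)] T'(1) unfolding triangle_component_def by blast
            then show False using t \<open>T' \<inter> nb v = {}\<close> by blast
          qed
        qed
        ultimately show ?thesis using T' by (auto simp: triangle_component_def)
      qed
      \<comment> \<open>\<open>T'\<close> has no edges to the rest of \<open>S - X\<close>, so
        deleting it creates no new triangle component there.\<close>
      have no_more: "\<nexists>T. triangle_component E (S - (X \<union> T')) T"
        if T': "triangle_component E (S - X) T'" "v \<in> T'"
          and none: "\<And>T. triangle_component E (S - X) T \<Longrightarrow> v \<in> T" for X T'
      proof
        assume "\<exists>T. triangle_component E (S - (X \<union> T')) T"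
        then obtain T where T: "triangle_component E (S - (X \<union> T')) T" by blast
        have "triangle_component E (S - X) T"
          using T T' symD unfolding triangle_component_def by blast
        then have "v \<in> T" by (rule none)
        then show False using T T'(2) unfolding triangle_component_def by blast
      qed
      show ?thesis
      proof (cases "\<exists>x T. triangle_component E S' T \<and> links T \<subseteq> {x}")
        case True
        then obtain x T where T: "triangle_component E S' T" "links T \<subseteq> {x}" by blast
        then have "x \<in> links T" using links_ne by blast
        then have xv: "x \<in> nb v" by (simp add: links_def)
        define X where "X = insert x (\<Union>{T. triangle_component E S' T \<and> links T \<subseteq> {x}})"
        have XS: "X \<subseteq> S" using xv by (auto simp: X_def triangle_component_def nb_def S'_def)
        have xX: "x \<in> X" and vX: "v \<notin> X" and Xnb: "X \<inter> nb v = {x}"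
          using xv vnb by (auto simp: X_def triangle_component_def S'_def)
        have closed: "w \<in> X" if "u \<in> X" "u \<noteq> x" "(u, w) \<in> E" "w \<in> S" for u w
          using that nbT unfolding X_def by blast
        have xT: "x \<notin> T" using T xv by (auto simp: triangle_component_def S'_def)
        have "card (insert x T) \<le> card X"
          using T XS fin finite_subset by (intro card_mono) (auto simp: X_def)
        then have cX: "4 \<le> card X"
          using T xT triangle_finite[of E T] by (simp add: triangle_component_def triangle_def)
        \<comment> \<open>The components in \<open>X\<close> have no neighbour outside themselves
          except \<open>x\<close>. Hence \<open>R\<close>, which misses \<open>x\<close>, would be
          one of them, but each is linked to \<open>x\<close>.\<close>
        have Xtri: "R \<inter> X = {}" if R: "R \<subseteq> S" "triangle E R" "x \<notin> R" "E `` {x} \<inter> R = {}" for R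
        proof (rule ccontr)
          assume "R \<inter> X \<noteq> {}"
          then obtain u where u: "u \<in> R" "u \<in> X" by blast
          then obtain T1 where T1: "triangle_component E S' T1" "links T1 \<subseteq> {x}" "u \<in> T1"
            using R by (auto simp: X_def)
          have "R \<subseteq> T1"
          proof
            fix w assume w: "w \<in> R"
            show "w \<in> T1"
              using nbT[OF T1(1,3), of w] w u R T1 by (cases "w = u") (auto simp: triangle_def)
          qed
          then have "R = T1"
            using R(2) T1(1) by (simp add: triangle_component_def triangle_subset_eq)
          moreover have "links T1 = {x}" using T1 links_ne by blast
          ultimately show False using R by (auto simp: links_def)
        qed
        have atv: "v \<in> T'" if T': "triangle_component E (S - X) T'" for T'
        proof (rule ccontr)
          assume "v \<notin> T'"
          then have "triangle_component E S' T' \<and> links T' \<subseteq> {x}"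
            using closed by (intro comp'[OF T' _ xX vX Xnb]) (auto simp: S'_def)
          then have "T' \<subseteq> X" by (auto simp: X_def)
          moreover have "T' \<noteq> {}" "T' \<subseteq> S - X" using T' by (auto simp: triangle_component_def triangle_def)
          ultimately show False by blast
        qed
        show ?thesis
        proof (cases "\<exists>T'. triangle_component E (S - X) T'")
          case False
          then show ?thesis using IH[of X x] XS xX cX Xtri by blast
        next
          case True
          then obtain T' where T': "triangle_component E (S - X) T'" by blast
          note vT' = atv[OF T']
          show ?thesis
          proof (rule IH[of "X \<union> T'" x])
            show "X \<union> T' \<subseteq> S" using XS T' by (auto simp: triangle_component_def)
            show "4 \<le> card (X \<union> T')"
              using cX card_mono[of "X \<union> T'" X] XS T' fin
              by (metis Un_upper1 finite_Un finite_subset le_trans triangle_component_def triangle_finite)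
            show "\<nexists>T. triangle_component E (S - (X \<union> T')) T"
              using no_more T' vT' atv by blast
            show "x \<in> S" using XS xX by blast
            fix R assume R: "R \<subseteq> S" "triangle E R" "x \<notin> R" "E `` {x} \<inter> R = {}"
            then have RX: "R \<inter> X = {}" by (rule Xtri)
            have vR: "v \<notin> R" using R xv symD by (auto simp: nb_def)
            \<comment> \<open>\<open>R\<close> lies in \<open>S - X\<close>, so meeting the
              component \<open>T'\<close> forces \<open>R = T'\<close>; but \<open>v\<close> is a
              neighbour of \<open>x\<close>.\<close>
            have "R \<inter> T' = {}"
            proof (rule ccontr)
              assume "R \<inter> T' \<noteq> {}"
              then obtain u where u: "u \<in> R" "u \<in> T'" by blast
              have "R \<subseteq> T'"
              proof
                fix w assume w: "w \<in> R"
                then have "w = u \<or> (u, w) \<in> E" using R(2) u(1) by (auto simp: triangle_def)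
                moreover have "w \<in> S - X" using w R(1) RX by blast
                ultimately show "w \<in> T'" using u(2) T' unfolding triangle_component_def by blast
              qed
              then have "R = T'"
                using R(2) T' by (simp add: triangle_component_def triangle_subset_eq)
              then show False using vR vT' by blast
            qed
            then show "R \<inter> (X \<union> T') = {}" using RX by blast
          qed
        qed
      next
        \<comment> \<open>From here on, every triangle component of \<open>S'\<close> has at least
          two links.\<close>
        case False
        obtain T where T: "triangle_component E S' T" using True by blast
        then obtain x where x: "x \<in> links T" using links_ne by blast
        then obtain y where y: "y \<in> T" "(x, y) \<in> E" and xv: "x \<in> nb v" by (auto simp: links_def)
        define X where "X = insert x T"
        have TS: "T \<subseteq> S'" and S'S: "S' \<subseteq> S" using T by (auto simp: triangle_component_def S'_def)
        have xS: "x \<in> S" using xv by (simp add: nb_def)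
        have XS: "X \<subseteq> S" using TS S'S xS by (auto simp: X_def)
        have xX: "x \<in> X" and vX: "v \<notin> X" and Xnb: "X \<inter> nb v = {x}"
          using xv vnb TS by (auto simp: X_def S'_def)
        have xT: "x \<notin> T" using TS xv by (auto simp: S'_def)
        have cX: "card X = 4"
          using T xT triangle_finite[of E T] by (simp add: X_def triangle_component_def triangle_def)
        have atv: "v \<in> T'" if T': "triangle_component E (S - X) T'" for T'
        proof (rule ccontr)
          assume "v \<notin> T'"
          then have "triangle_component E S' T' \<and> links T' \<subseteq> {x}"
            using T by (intro comp'[OF T' _ xX vX Xnb]) (auto simp: X_def triangle_component_def)
          then show False using False by blast
        qed
        show ?thesis
        proof (cases "\<exists>T'. triangle_component E (S - X) T'")
          case False
          show ?thesis
          proof (rule IH[of X y])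
            show "y \<in> S" using y TS S'S by blast
            fix R assume R: "R \<subseteq> S" "triangle E R" "y \<notin> R" "E `` {y} \<inter> R = {}"
            have "X \<subseteq> insert y (E `` {y})"
              using T y symD by (auto simp: X_def triangle_component_def triangle_def)
            then show "R \<inter> X = {}" using R by blast
          qed (use XS cX False in auto)
        next
          case True
          then obtain T' where T': "triangle_component E (S - X) T'" by blast
          note vT' = atv[OF T']
          \<comment> \<open>Inside \<open>S - X\<close> the neighbours of \<open>v\<close> stay in
            \<open>T'\<close>, and \<open>x\<close> is its only neighbour in \<open>X\<close>; so
            the maximal degree is exactly 3.\<close>
          have nbv: "nb v = insert x (T' - {v})"
          proof
            show "nb v \<subseteq> insert x (T' - {v})"
              using T' vT' Xnb irr unfolding nb_def triangle_component_def by blast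
            show "insert x (T' - {v}) \<subseteq> nb v"
              using T' vT' xv by (auto simp: nb_def triangle_component_def triangle_def)
          qed
          have T'S: "T' \<subseteq> S" and T't: "triangle E T'" and T'X: "T' \<inter> X = {}"
            using T' by (auto simp: triangle_component_def)
          have Tt: "triangle E T" using T by (simp add: triangle_component_def)
          have deg3: "card (nb v) = 3"
          proof -
            have "card (T' - {v}) = 2" "x \<notin> T'"
              using T't vT' T'X xX unfolding triangle_def by (simp, blast)
            then show ?thesis using triangle_finite[OF T't] by (simp add: nbv)
          qed
          have max3: "card W \<le> 3" if "W \<subseteq> nb u" "u \<in> S" for W u
            by (rule order_trans[OF card_mono[OF finnb that(1)] order_trans[OF v(2)[OF that(2)]]])
              (simp add: deg3)
          \<comment> \<open>two neighbours of \<open>u\<close> outside \<open>A\<close> would give \<open>u\<close> degree 4, but the maximal degree is 3\<close>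
          have cross: "p = q"
            if A: "triangle E A" "A \<subseteq> S" and B: "B \<subseteq> S" "A \<inter> B = {}"
              and e: "u \<in> A" "p \<in> B" "q \<in> B" "(u, p) \<in> E" "(u, q) \<in> E" for A B u p q
          proof (rule ccontr)
            assume "p \<noteq> q"
            obtain a b where ab: "A = {u, a, b}" "a \<noteq> b" "a \<noteq> u" "b \<noteq> u" using triangleE A(1) e(1) .
            have "{a, b, p, q} \<subseteq> nb u" using ab A B e by (auto simp: nb_def triangle_def)
            then have "card {a, b, p, q} \<le> 3" using max3 e A by blast
            moreover have "a \<noteq> p" "a \<noteq> q" "b \<noteq> p" "b \<noteq> q" using ab B e by blast+
            then have "card {a, b, p, q} = 4" using ab \<open>p \<noteq> q\<close> by simp
            ultimately show False by simp
          qed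
          \<comment> \<open>\<open>x\<close> replaces \<open>y\<close> as the chosen vertex because
            it is adjacent to both triangles: to \<open>y\<close> in \<open>T\<close> and to
            \<open>v\<close> in \<open>T'\<close>.\<close>
          show ?thesis
          proof (rule IH[of "X \<union> T'" x])
            show "X \<union> T' \<subseteq> S" using XS T'S by blast
            show "4 \<le> card (X \<union> T')"
              using cX card_mono[of "X \<union> T'" X] XS T'S fin by (metis Un_least Un_upper1 finite_subset)
            show "\<nexists>T. triangle_component E (S - (X \<union> T')) T"
              using no_more T' vT' atv by blast
            show "x \<in> S" by (rule xS)
            fix R assume R: "R \<subseteq> S" "triangle E R" "x \<notin> R" "E `` {x} \<inter> R = {}"
            have vR: "v \<notin> R" using R xv symD by (auto simp: nb_def)
            have yR: "y \<notin> R" using R y by blast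
            show "R \<inter> (X \<union> T') = {}"
            proof (rule ccontr)
              assume "R \<inter> (X \<union> T') \<noteq> {}"
              then obtain u where u: "u \<in> R" "u \<in> T \<union> T'" using R by (auto simp: X_def)
              \<comment> \<open>By \<open>nbv\<close>, the links of \<open>T\<close> other than
                \<open>x\<close> lie in \<open>T'\<close>. As \<open>R\<close> misses
                \<open>x\<close>, it cannot leave the two triangles.\<close>
              have links: "links T \<subseteq> insert x T'" using nbv by (auto simp: links_def)
              have "R \<subseteq> T \<union> T'"
              proof
                fix w assume w: "w \<in> R"
                show "w \<in> T \<union> T'"
                proof (cases "w = u")
                  case False
                  then have uw: "(u, w) \<in> E" "w \<in> S" "w \<noteq> x" using R u w by (auto simp: triangle_def)
                  show ?thesis
                  proof (cases "u \<in> T")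
                    case True
                    then show ?thesis using nbT[OF T True uw(1,2)] links uw by blast
                  next
                    case False
                    then show ?thesis using u uw T' by (auto simp: triangle_component_def X_def)
                  qed
                qed (use u in simp)
              qed
              have disj: "T \<inter> T' = {}" using T'X by (auto simp: X_def)
              obtain a b where ab: "R = {u, a, b}" "a \<noteq> b" "a \<noteq> u" "b \<noteq> u" using triangleE R(2) u(1) .
              have adj: "(u, a) \<in> E" "(u, b) \<in> E" "(a, b) \<in> E" "(a, u) \<in> E" "(b, u) \<in> E" "(b, a) \<in> E"
                using R(2) ab by (auto simp: triangle_def)
              have nT: "\<not> R \<subseteq> T" and nT': "\<not> R \<subseteq> T'"
                using triangle_subset_eq[OF R(2) Tt] triangle_subset_eq[OF R(2) T't] yR y(1) vR vT'
                by blast+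
              have TSS: "T \<subseteq> S" using TS S'S by blast
              note c1 = cross[OF Tt TSS T'S disj] and
                c2 = cross[OF T't T'S TSS disj[unfolded Int_commute[of T]]]
              \<comment> \<open>\<open>R\<close> has one vertex in one triangle and two in the
                other; the latter are distinct neighbours of the former, against
                \<open>cross\<close>.\<close>
              have "u \<in> T \<or> u \<in> T'" "a \<in> T \<or> a \<in> T'" "b \<in> T \<or> b \<in> T'"
                using \<open>R \<subseteq> T \<union> T'\<close> ab(1) by blast+
              moreover have "\<not> (u \<in> T \<and> a \<in> T \<and> b \<in> T)" "\<not> (u \<in> T' \<and> a \<in> T' \<and> b \<in> T')"
                using nT nT' ab(1) by blast+
              ultimately show False
                using adj ab(2-4) c1[of u a b] c1[of a u b] c1[of b u a]
                  c2[of u a b] c2[of a u b] c2[of b u a] by argo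
            qed
          qed
        qed
      qed
    qed
  qed
qed

section \<open>From digraph isomorphisms to triangles of a relation\<close>

lemma contains_K3_iff_triangle:
  fixes G :: "'a pair_pre_digraph"
  assumes "U \<subseteq> pverts G"
  shows "contains_K3 (with_proj G \<restriction> U) \<longleftrightarrow> (\<exists>T\<subseteq>U. triangle (parcs G) T)"
proof
  assume "contains_K3 (with_proj G \<restriction> U)"
  then obtain H where H: "subgraph H (with_proj G \<restriction> U)" and "digraph_iso H (with_proj K3)"
    by (auto simp: contains_K3_def)
  then obtain h where h: "pre_digraph.digraph_isomorphism H h" and K: "with_proj K3 = app_iso h H"
    unfolding digraph_iso_def by blast
  interpret pre_digraph H .
  have inj: "inj_on (iso_verts h) (verts H)" using h by (simp add: digraph_isomorphism_def)
  have V: "iso_verts h ` verts H = {1..3}"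
    using arg_cong[OF K, of verts] by (simp add: K3_def complete_on_def)
  have A: "iso_arcs h ` arcs H = parcs K3" using arg_cong[OF K, of arcs] by simp
  have "card (verts H) = 3" using card_image[OF inj] V by simp
  moreover have "(u, w) \<in> parcs G" if uw: "u \<in> verts H" "w \<in> verts H" "u \<noteq> w" for u w
  proof -
    have "(iso_verts h u, iso_verts h w) \<in> parcs K3"
      using uw V inj by (auto simp: K3_def complete_on_def inj_on_def)
    then obtain e where e: "e \<in> arcs H" "iso_arcs h e = (iso_verts h u, iso_verts h w)"
      using A by (metis imageE)
    have wf: "wf_digraph H" using h by (simp add: digraph_isomorphism_def)
    \<comment> \<open>Both sides of \<open>K\<close> are compared in their tail and head maps at the
      image of \<open>e\<close>; injectivity on vertices then identifies the ends of
      \<open>e\<close>.\<close>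
    have "iso_verts h (tail H e) = iso_verts h u" "iso_verts h (head H e) = iso_verts h w"
      using e h arg_cong[OF K, of "\<lambda>G. tail G (iso_arcs h e)"]
        arg_cong[OF K, of "\<lambda>G. head G (iso_arcs h e)"]
      by (simp_all add: digraph_isomorphism_def)
    then have "tail H e = u" "head H e = w"
      using inj_onD[OF inj] uw e wf_digraph.wellformed[OF wf] by blast+
    moreover have "e \<in> parcs G" "tail H e = fst e" "head H e = snd e"
      using H e by (auto simp: subgraph_def compatible_def)
    ultimately show ?thesis by (metis prod.collapse)
  qed
  moreover have "verts H \<subseteq> U" using H by (auto simp: subgraph_def)
  ultimately show "\<exists>T\<subseteq>U. triangle (parcs G) T" by (auto simp: triangle_def)
next
  assume "\<exists>T\<subseteq>U. triangle (parcs G) T"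
  then obtain T where T: "T \<subseteq> U" "triangle (parcs G) T" by blast
  have "subgraph (with_proj (complete_on T)) (with_proj G \<restriction> U)"
    using T by (auto simp: subgraph_def compatible_def wf_digraph_def complete_on_def triangle_def)
  moreover have "digraph_iso (with_proj (complete_on T)) (with_proj K3)"
    using T by (intro digraph_iso_K3_complete_on) (simp add: triangle_def)
  ultimately show "contains_K3 (with_proj G \<restriction> U)" by (auto simp: contains_K3_def)
qed

lemma K3_isolating_iff:
  "K3_isolating G D \<longleftrightarrow> triangle_isolating (parcs G) (pverts G) D"
proof -
  have "pverts G - closed_nbhd_set G D = pverts G - (D \<union> parcs G `` D)"
    by (auto simp: closed_nbhd_set_def closed_nbhd_def)
  then show ?thesis
    using contains_K3_iff_triangle[of "pverts G - closed_nbhd_set G D" G]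
    by (auto simp: K3_isolating_def triangle_isolating_def)
qed

text \<open>Walks starting in a triangle component never leave it, so by connectedness it is the
  whole graph, which would then be a copy of \<open>K3\<close>.\<close>

lemma admissible_no_triangle_component:
  assumes "G \<in> admissible_graphs n"
  shows "\<nexists>T. triangle_component (parcs G) (pverts G) T"
proof
  assume "\<exists>T. triangle_component (parcs G) (pverts G) T"
  then obtain T where T: "T \<subseteq> pverts G" "triangle (parcs G) T"
    "parcs G `` T \<inter> pverts G \<subseteq> T"
    by (auto simp: triangle_component_def)
  interpret pair_graph G using assms by (simp add: admissible_graphs_def)
  have "T \<noteq> {}" using T by (auto simp: triangle_def)
  then obtain u where u: "u \<in> T" by blast
  have con: "Digraph_Component.connected (with_proj G)"
    using assms by (simp add: admissible_graphs_def)
  have "w \<in> T" if w: "w \<in> pverts G" for w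
  proof -
    have "u \<rightarrow>\<^sup>*\<^bsub>G\<^esub> w"
      using symmetric_connected_imp_strongly_connected[OF pair_sym_arcs con] w u T(1)
      by (auto simp: strongly_connected_def)
    then show ?thesis
    proof (induction rule: reachable_induct)
      case base
      show ?case by (rule u)
    next
      case (step x y)
      have "(x, y) \<in> parcs G" using step by simp
      then show ?case using T(3) step.IH in_arcsD2 by blast
    qed
  qed
  then have "pverts G = T" using T by blast
  moreover have "(u, w) \<in> parcs G \<longleftrightarrow> u \<in> T \<and> w \<in> T \<and> u \<noteq> w" for u w
    using T(2) \<open>pverts G = T\<close> no_loops[of "(u, w)"] in_arcsD1[of u w] in_arcsD2[of u w]
    by (auto simp: triangle_def)
  then have "parcs G = {(u, w). u \<in> T \<and> w \<in> T \<and> u \<noteq> w}" by auto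
  ultimately have "G = complete_on T" by (simp add: complete_on_def)
  then show False
    using assms digraph_iso_K3_complete_on[of T] T(2) by (auto simp: admissible_graphs_def triangle_def)
qed

lemma iota_K3_le_div_4:
  assumes G: "G \<in> admissible_graphs n"
  shows "iota_K3 G \<le> n div 4"
proof -
  interpret pair_graph G using G by (simp add: admissible_graphs_def)
  have "sym (parcs G)" using pair_sym_arcs by (simp add: symmetric_def)
  moreover have "irrefl (parcs G)" 
    using no_loops[of "(a, a)" for a] by (auto intro!: irreflI)
  ultimately obtain D where D: "triangle_isolating (parcs G) (pverts G) D"
    "4 * card D \<le> card (pverts G)"
    using triangle_isolation_bound[of "parcs G" "pverts G"]
      admissible_no_triangle_component[OF G] by auto
  have "iota_K3 G \<le> card D"
    unfolding iota_K3_def using D(1)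
    by (intro Min_le iota_K3_sizes) (auto simp: K3_isolating_iff)
  moreover have "card (pverts G) = n" using G by (simp add: admissible_graphs_def)
  ultimately show ?thesis using D(2) by linarith
qed

section \<open>The lower bound for \<open>B_graph n\<close>\<close>

lemma iota_K3_B_graph_ge: "n div 4 \<le> iota_K3 (B_graph n)"
proof (cases "n \<le> 3")
  case False
  define a b where "a = n div 4" and "b = n - 3 * a"
  have ab: "a \<le> b" "n = b + 3 * a" using False by (auto simp: a_def b_def)
  have B: "B_graph n =
     \<lparr> pverts = pverts (P_star a b) \<union> (\<Union>i\<in>{1..a}. pverts (F_copy b i)),
       parcs = parcs (P_star a b) \<union> (\<Union>i\<in>{1..a}. parcs (F_copy b i)) \<union>
         symcl {(i, x) | i x. i \<in> {1..a} \<and> x \<in> pverts (F_copy b i)} \<rparr>"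
    using False by (simp add: B_graph_def Let_def flip: a_def b_def)
  have F: "pverts (F_copy b i) = {b + 3 * i - 2..b + 3 * i}" for i
    by (simp add: F_copy_def complete_on_def)
  \<comment> \<open>For indices at least 1 the truncated subtraction is exact, so the blocks are
    pairwise disjoint.\<close>
  have block: "i = j" if "1 \<le> i" "1 \<le> j" "b + 3 * i - 2 \<le> u" "u \<le> b + 3 * i"
    "b + 3 * j - 2 \<le> u" "u \<le> b + 3 * j" for i j u :: nat
    using that by linarith
  \<comment> \<open>the closed neighbourhood of \<open>F\<^sub>i\<close>\<close>
  define A where "A i = insert i {b + 3 * i - 2..b + 3 * i}" for i
  have "a \<le> card D" if D: "K3_isolating (B_graph n) D" for D
  proof -
    have "D \<inter> A i \<noteq> {}" if i: "i \<in> {1..a}" for i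
    proof
      assume DA: "D \<inter> A i = {}"
      let ?T = "{b + 3 * i - 2..b + 3 * i}"
      have tri: "triangle (parcs (B_graph n)) ?T"
        using i by (auto simp: triangle_def B F_copy_def complete_on_def)
      \<comment> \<open>Arcs of \<open>P_star a b\<close> stay within \<open>{1..b}\<close>, below
        every block, so the only outside neighbour of block \<open>i\<close> is
        \<open>i\<close>.\<close>
      have "w \<in> A i" if "(w, u) \<in> parcs (B_graph n)" "u \<in> ?T" for u w
        using that i ab(1) block[of i]
        by (fastforce simp: B P_star_def path_graph_def F_copy_def complete_on_def symcl_def A_def)
      moreover have "?T \<subseteq> A i" by (auto simp: A_def)
      ultimately have "?T \<inter> (D \<union> parcs (B_graph n) `` D) = {}" using DA by blast
      moreover have "?T \<subseteq> pverts (B_graph n)" using i by (auto simp: B F)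
      ultimately have "?T \<subseteq> pverts (B_graph n) - (D \<union> parcs (B_graph n) `` D)" by blast
      then show False using D tri by (metis K3_isolating_iff triangle_isolating_def)
    qed
    then have "\<forall>i\<in>{1..a}. \<exists>x. x \<in> D \<inter> A i" by blast
    then obtain f where f: "\<And>i. i \<in> {1..a} \<Longrightarrow> f i \<in> D \<inter> A i" by metis
    \<comment> \<open>The sets \<open>A i\<close> are disjoint: the indices satisfy
      \<open>i \<le> a \<le> b\<close> and so lie below all blocks.\<close>
    have "i = j" if "i \<in> {1..a}" "j \<in> {1..a}" "f i = f j" for i j
    proof -
      have "f i \<in> A i" "f i \<in> A j" using f[OF that(1)] f[OF that(2)] that(3) by auto
      then show ?thesis using that(1,2) ab by (auto simp: A_def)
    qed
    then have "inj_on f {1..a}" by (auto simp: inj_on_def)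
    moreover have "f ` {1..a} \<subseteq> D" using f by auto
    moreover have "finite D" using D by (auto simp: K3_isolating_def pverts_B_graph intro: finite_subset)
    ultimately show ?thesis by (metis card_atLeastAtMost card_inj_on_le diff_Suc_1)
  qed
  moreover have "finite (pverts (B_graph n))" by (simp add: pverts_B_graph)
  ultimately show ?thesis
    unfolding iota_K3_def a_def[symmetric] by (intro Min.boundedI iota_K3_sizes) auto
qed simp

text \<open>The two bounds meet at \<open>B_graph n\<close>, which is itself admissible and
  therefore attains the maximum.\<close>

theorem theorem1p3:
  fixes n :: nat
  assumes "n \<ge> 1"
  shows "iota_max_K3 n = iota_K3 (B_graph n) \<and> iota_K3 (B_graph n) = n div 4"
proof
  note B = B_graph_admissible[OF assms]
  show eq: "iota_K3 (B_graph n) = n div 4"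
    using iota_K3_le_div_4[OF B] iota_K3_B_graph_ge by (rule antisym)
  show "iota_max_K3 n = iota_K3 (B_graph n)"
    unfolding iota_max_K3_def
  proof (rule Max_eqI)
    show "finite {iota_K3 G | G. G \<in> admissible_graphs n}"
      using finite_admissible_graphs by simp
    show "iota_K3 (B_graph n) \<in> {iota_K3 G | G. G \<in> admissible_graphs n}" using B by blast
  qed (use iota_K3_le_div_4 eq in auto)
qed

end
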